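(* Let $A$ be a commutative Banach algebra. Then the following are true: (1) for every $n\in\mathbb{N}$, if $A$ has no non-zero bounded derivations of rank less than $n$ into $A^*$, then, for every symmetric Banach $A$-bimodule $E$, $A$ has no non-zero bounded derivations of rank less than $n$ into $E$; (2) if $A$ has no non-zero compact derivations into $A^*$, then, for every symmetric Banach $A$-bimodule $E$, $A$ has no non-zero compact derivations into $E$; (3) if $A$ has no non-zero weakly compact derivations into $A^*$, then, for every symmetric Banach $A$-bimodule $E$, $A$ has no non-zero weakly compact derivations into $E$.
   Context: All Banach spaces are over $\mathbb{C}$, and $\mathbb{N}=\{1,2,\dots\}$. Algebras are not assumed to be unital. For a Banach algebra $A$, a Banach $A$-bimodule is a Banach space $E$ together with two bounded bilinear maps $A\times E\to E$, denoted $(a,x)\mapsto a\cdot x$ and $(a,x)\mapsto x\cdot a$, such that $a\cdot(b\cdot x)=(ab)\cdot x$, $(x\cdot a)\cdot b=x\cdot(ab)$ and $a\cdot(x\cdot b)=(a\cdot x)\cdot b$ for all $a,b\in A$, $x\in E$. It is symmetric if $a\cdot x=x\cdot a$ for all $a\in A$, $x\in E$. A derivation from $A$ into $E$ is a linear map $D:A\to E$ with $D(ab)=a\cdot D(b)+D(a)\cdot b$ for all $a,b\in A$. The topological dual $A^*$ is a Banach $A$-bimodule with actions $(a\cdot\psi)(x)=\psi(xa)$ and $(\psi\cdot a)(x)=\psi(ax)$ for $a,x\in A$, $\psi\in A^*$. The rank of a linear map is the dimension of its image. A linear map between Banach spaces is compact (respectively weakly compact) if the image of the closed unit ball has compact norm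 closure (respectively weakly compact weak closure). *)

theory Defs
  imports "HOL-Analysis.Analysis" "HOL-Library.Extended_Nat"
begin

section \<open>Complex Banach spaces and complex Banach algebras\<close>

class scaleC =
  fixes scaleC :: "complex \<Rightarrow> 'a \<Rightarrow> 'a"  (infixr \<open>*\<^sub>C\<close> 75)

class complex_vector = real_vector + scaleC +
  assumes scaleC_add_right: "c *\<^sub>C (x + y) = c *\<^sub>C x + c *\<^sub>C y"
    and scaleC_add_left: "(c + d) *\<^sub>C x = c *\<^sub>C x + d *\<^sub>C x"
    and scaleC_scaleC: "c *\<^sub>C d *\<^sub>C x = (c * d) *\<^sub>C x"
    and scaleC_one: "1 *\<^sub>C x = x"
    and scaleR_scaleC: "scaleR r x = complex_of_real r *\<^sub>C x"

global_interpretation complex_vector: vector_space "scaleC :: complex \<Rightarrow> 'a \<Rightarrow> 'a::complex_vector"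
  by unfold_locales (simp_all add: scaleC_add_right scaleC_add_left scaleC_scaleC scaleC_one)

class complex_normed_vector = complex_vector + real_normed_vector +
  assumes norm_scaleC: "norm (c *\<^sub>C x) = cmod c * norm x"

class complex_banach = complex_normed_vector + banach

text \<open>Not assumed to be unital. Submultiplicativity of the norm comes from
  \<^class>\<open>real_normed_algebra\<close>.\<close>

class complex_banach_algebra = complex_banach + real_normed_algebra +
  assumes scaleC_mult_left: "(c *\<^sub>C a) * b = c *\<^sub>C (a * b)"
    and scaleC_mult_right: "a * (c *\<^sub>C b) = c *\<^sub>C (a * b)"


section \<open>The topological dual\<close>

text \<open>For a complex-linear functional, the operator norm over the reals carried by
  \<^typ>\<open>'a \<Rightarrow>\<^sub>L complex\<close> is its operator norm over the complex numbers.\<close>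

typedef (overloaded) 'a cdual =
  "{f :: 'a::complex_normed_vector \<Rightarrow>\<^sub>L complex. \<forall>c x. blinfun_apply f (c *\<^sub>C x) = c * blinfun_apply f x}"
  morphisms blinfun_of_cdual Abs_cdual
  by (rule exI[of _ 0]) simp

setup_lifting type_definition_cdual

lift_definition cdual_apply :: "'a::complex_normed_vector cdual \<Rightarrow> 'a \<Rightarrow> complex"
  is blinfun_apply .

instantiation cdual :: (complex_normed_vector) complex_normed_vector
begin

lift_definition zero_cdual :: "'a cdual" is 0 by simp
lift_definition plus_cdual :: "'a cdual \<Rightarrow> 'a cdual \<Rightarrow> 'a cdual" is "(+)"
  by (simp add: blinfun.add_left algebra_simps)
lift_definition minus_cdual :: "'a cdual \<Rightarrow> 'a cdual \<Rightarrow> 'a cdual" is "(-)"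
  by (simp add: blinfun.diff_left algebra_simps)
lift_definition uminus_cdual :: "'a cdual \<Rightarrow> 'a cdual" is uminus
  by (simp add: blinfun.minus_left)
lift_definition scaleR_cdual :: "real \<Rightarrow> 'a cdual \<Rightarrow> 'a cdual" is scaleR
  by (simp add: blinfun.scaleR_left)
lift_definition scaleC_cdual :: "complex \<Rightarrow> 'a cdual \<Rightarrow> 'a cdual"
  is "\<lambda>c f. blinfun_mult_right c o\<^sub>L f"
  by simp
lift_definition norm_cdual :: "'a cdual \<Rightarrow> real" is norm .

definition dist_cdual :: "'a cdual \<Rightarrow> 'a cdual \<Rightarrow> real"
  where "dist_cdual f g = norm (f - g)"
definition sgn_cdual :: "'a cdual \<Rightarrow> 'a cdual"
  where "sgn_cdual f = scaleR (inverse (norm f)) f"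
definition uniformity_cdual :: "('a cdual \<times> 'a cdual) filter"
  where "uniformity_cdual = (INF e\<in>{0<..}. principal {(f, g). dist f g < e})"
definition open_cdual :: "'a cdual set \<Rightarrow> bool"
  where "open_cdual U = (\<forall>f\<in>U. \<forall>\<^sub>F (f', g) in uniformity. f' = f \<longrightarrow> g \<in> U)"

instance
proof
  fix f g h :: "'a cdual" and r s :: real and c d :: complex
  show "f + g + h = f + (g + h)" by transfer simp
  show "f + g = g + f" by transfer simp
  show "0 + f = f" by transfer simp
  show "- f + f = 0" by transfer simp
  show "f - g = f + - g" by transfer simp
  show "r *\<^sub>R (f + g) = r *\<^sub>R f + r *\<^sub>R g" by transfer (simp add: scaleR_add_right)
  show "(r + s) *\<^sub>R f = r *\<^sub>R f + s *\<^sub>R f" by transfer (simp add: scaleR_add_left)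
  show "r *\<^sub>R s *\<^sub>R f = (r * s) *\<^sub>R f" by transfer simp
  show "1 *\<^sub>R f = f" by transfer simp
  show "c *\<^sub>C (f + g) = c *\<^sub>C f + c *\<^sub>C g"
    by transfer (auto intro!: blinfun_eqI simp: blinfun.add_left algebra_simps)
  show "(c + d) *\<^sub>C f = c *\<^sub>C f + d *\<^sub>C f"
    by transfer (auto intro!: blinfun_eqI simp: blinfun.add_left algebra_simps)
  show "c *\<^sub>C d *\<^sub>C f = (c * d) *\<^sub>C f"
    by transfer (auto intro!: blinfun_eqI)
  show "1 *\<^sub>C f = f"
    by transfer (auto intro!: blinfun_eqI)
  show "r *\<^sub>R f = complex_of_real r *\<^sub>C f"
    by transfer (auto intro!: blinfun_eqI simp: blinfun.scaleR_left scaleR_conv_of_real)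
  show "dist f g = norm (f - g)" by (rule dist_cdual_def)
  show "sgn f = scaleR (inverse (norm f)) f" by (rule sgn_cdual_def)
  show "uniformity = (INF e\<in>{0<..}. principal {(x, y). dist (x::'a cdual) y < e})"
    by (rule uniformity_cdual_def)
  show "open U = (\<forall>x\<in>U. \<forall>\<^sub>F (x', y) in uniformity. x' = x \<longrightarrow> y \<in> U)" for U :: "'a cdual set"
    by (rule open_cdual_def)
  show "(norm f = 0) = (f = 0)" by transfer simp
  show "norm (f + g) \<le> norm f + norm g" by transfer (rule norm_triangle_ineq)
  show "norm (r *\<^sub>R f) = \<bar>r\<bar> * norm f" by transfer simp
  show "norm (c *\<^sub>C f) = cmod c * norm f"
  proof transfer
    fix c and f :: "'a \<Rightarrow>\<^sub>L complex"
    show "norm (blinfun_mult_right c o\<^sub>L f) = cmod c * norm f"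
    proof (cases "c = 0")
      case True
      then have "blinfun_mult_right c o\<^sub>L f = 0" by (auto intro!: blinfun_eqI)
      with True show ?thesis by simp
    next
      case False
      show ?thesis
      proof (rule antisym)
        show "norm (blinfun_mult_right c o\<^sub>L f) \<le> cmod c * norm f"
          by (rule norm_blinfun_bound)
            (use norm_blinfun[of f] in \<open>auto simp: norm_mult mult.assoc intro!: mult_left_mono\<close>)
        have "norm f \<le> norm (blinfun_mult_right c o\<^sub>L f) / cmod c"
        proof (rule norm_blinfun_bound)
          fix x
          have "cmod c * norm (f x) \<le> norm (blinfun_mult_right c o\<^sub>L f) * norm x"
            using norm_blinfun[of "blinfun_mult_right c o\<^sub>L f" x] by (simp add: norm_mult)
          then show "norm (f x) \<le> norm (blinfun_mult_right c o\<^sub>L f) / cmod c * norm x"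
            using False by (simp add: field_simps)
        qed simp
        then show "cmod c * norm f \<le> norm (blinfun_mult_right c o\<^sub>L f)"
          using False by (simp add: field_simps)
      qed
    qed
  qed
qed

end

lemma cdual_eqI: "(\<And>x. cdual_apply f x = cdual_apply g x) \<Longrightarrow> f = g"
  by transfer (rule blinfun_eqI)

lemma cdual_apply_simps [simp]:
  "cdual_apply 0 x = 0"
  "cdual_apply (f + g) x = cdual_apply f x + cdual_apply g x"
  "cdual_apply (f - g) x = cdual_apply f x - cdual_apply g x"
  "cdual_apply (- f) x = - cdual_apply f x"
  "cdual_apply (c *\<^sub>C f) x = c * cdual_apply f x"
  "cdual_apply (r *\<^sub>R f) x = r *\<^sub>R cdual_apply f x"
  by (transfer; simp add: blinfun.add_left blinfun.diff_left blinfun.minus_left blinfun.scaleR_left)+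

lemma bounded_linear_cdual_apply: "bounded_linear (cdual_apply f)"
  by transfer (rule blinfun.bounded_linear_right)

lemma cdual_apply_scaleC: "cdual_apply f (c *\<^sub>C x) = c * cdual_apply f x"
  by transfer simp

lemma norm_cdual_eq_onorm: "norm f = onorm (cdual_apply f)"
  by transfer (rule norm_blinfun.rep_eq)

instance cdual :: (complex_normed_vector) complex_banach
proof
  fix X :: "nat \<Rightarrow> 'a cdual"
  assume X: "Cauchy X"
  let ?Y = "\<lambda>n. blinfun_of_cdual (X n)"
  have dist_eq: "dist (blinfun_of_cdual f) (blinfun_of_cdual g) = dist f g" for f g :: "'a cdual"
    unfolding dist_norm by transfer simp
  have "Cauchy ?Y" using X by (simp add: Cauchy_def dist_eq)
  then obtain L where L: "?Y \<longlonglongrightarrow> L" by (meson Cauchy_convergent convergent_def)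
  have app: "(\<lambda>n. ?Y n x) \<longlonglongrightarrow> L x" for x
    by (intro tendsto_intros L)
  have "L (c *\<^sub>C x) = c * L x" for c x
  proof (rule LIMSEQ_unique)
    show "(\<lambda>n. ?Y n (c *\<^sub>C x)) \<longlonglongrightarrow> L (c *\<^sub>C x)" by (rule app)
    have "?Y n (c *\<^sub>C x) = c * ?Y n x" for n using blinfun_of_cdual[of "X n"] by simp
    then show "(\<lambda>n. ?Y n (c *\<^sub>C x)) \<longlonglongrightarrow> c * L x"
      using tendsto_mult_left[OF app] by simp
  qed
  then have "blinfun_of_cdual (Abs_cdual L) = L" by (simp add: Abs_cdual_inverse)
  then have "X \<longlonglongrightarrow> Abs_cdual L"
    using L unfolding tendsto_iff dist_eq[symmetric] by simp
  then show "convergent X" by (auto simp: convergent_def)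
qed


section \<open>Banach bimodules and derivations\<close>

locale banach_bimodule =
  fixes lact :: "'a::complex_banach_algebra \<Rightarrow> 'e::complex_banach \<Rightarrow> 'e"  (infixr \<open>\<rhd>\<close> 75)
    and ract :: "'e \<Rightarrow> 'a \<Rightarrow> 'e"  (infixl \<open>\<lhd>\<close> 75)
  assumes bounded_bilinear_lact: "bounded_bilinear (\<rhd>)"
    and lact_scaleC_left: "(c *\<^sub>C a) \<rhd> x = c *\<^sub>C (a \<rhd> x)"
    and lact_scaleC_right: "a \<rhd> (c *\<^sub>C x) = c *\<^sub>C (a \<rhd> x)"
    and bounded_bilinear_ract: "bounded_bilinear (\<lhd>)"
    and ract_scaleC_left: "(c *\<^sub>C x) \<lhd> a = c *\<^sub>C (x \<lhd> a)"
    and ract_scaleC_right: "x \<lhd> (c *\<^sub>C a) = c *\<^sub>C (x \<lhd> a)"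
    and lact_lact: "a \<rhd> (b \<rhd> x) = (a * b) \<rhd> x"
    and ract_ract: "(x \<lhd> a) \<lhd> b = x \<lhd> (a * b)"
    and lact_ract: "a \<rhd> (x \<lhd> b) = (a \<rhd> x) \<lhd> b"

locale symmetric_banach_bimodule = banach_bimodule +
  assumes symmetric: "lact a x = ract x a"

definition derivation ::
  "('a::complex_banach_algebra \<Rightarrow> 'e::complex_banach \<Rightarrow> 'e) \<Rightarrow> ('e \<Rightarrow> 'a \<Rightarrow> 'e) \<Rightarrow> ('a \<Rightarrow> 'e) \<Rightarrow> bool"
  where "derivation lact ract D \<longleftrightarrow>
    Vector_Spaces.linear scaleC scaleC D \<and> (\<forall>a b. D (a * b) = lact a (D b) + ract (D a) b)"

lift_definition dual_lact :: "'a::complex_banach_algebra \<Rightarrow> 'a cdual \<Rightarrow> 'a cdual"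
  is "\<lambda>a \<psi>. \<psi> o\<^sub>L blinfun_mult_left a"
  by (simp add: scaleC_mult_left)

lift_definition dual_ract :: "'a::complex_banach_algebra cdual \<Rightarrow> 'a \<Rightarrow> 'a cdual"
  is "\<lambda>\<psi> a. \<psi> o\<^sub>L blinfun_mult_right a"
  by (simp add: scaleC_mult_right)

lemma dual_lact_apply: "cdual_apply (dual_lact a \<psi>) x = cdual_apply \<psi> (x * a)"
  by transfer simp

lemma dual_ract_apply: "cdual_apply (dual_ract \<psi> a) x = cdual_apply \<psi> (a * x)"
  by transfer simp

lemma banach_bimodule_cdual: "banach_bimodule dual_lact dual_ract"
proof -
  have lin: "cdual_apply \<psi> (x + y) = cdual_apply \<psi> x + cdual_apply \<psi> y"
    "cdual_apply \<psi> (r *\<^sub>R x) = r *\<^sub>R cdual_apply \<psi> x" for \<psi> :: "'a cdual" and x y r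
    by (transfer; simp add: blinfun.add_right blinfun.scaleR_right)+
  note simps = dual_lact_apply dual_ract_apply lin cdual_apply_scaleC scaleC_mult_left
    scaleC_mult_right mult.assoc distrib_left distrib_right
  have nl: "norm (dual_lact a \<psi>) \<le> norm a * norm \<psi> * 1"
    and nr: "norm (dual_ract \<psi> a) \<le> norm \<psi> * norm a * 1" for a and \<psi> :: "'a cdual"
  proof -
    have b: "cmod (cdual_apply \<psi> x) \<le> norm \<psi> * norm x" for \<psi> :: "'a cdual" and x
      by transfer (rule norm_blinfun)
    have *: "norm \<phi> \<le> B" if "0 \<le> B" "\<And>x. cmod (cdual_apply \<phi> x) \<le> B * norm x"
      for \<phi> :: "'a cdual" and B
      using that by transfer (rule norm_blinfun_bound)
    show "norm (dual_lact a \<psi>) \<le> norm a * norm \<psi> * 1"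
    proof (rule *)
      fix x
      have "norm \<psi> * norm (x * a) \<le> norm \<psi> * (norm x * norm a)"
        by (intro mult_left_mono norm_mult_ineq norm_ge_zero)
      with b[of \<psi> "x * a"]
      show "cmod (cdual_apply (dual_lact a \<psi>) x) \<le> norm a * norm \<psi> * 1 * norm x"
        by (simp add: dual_lact_apply mult_ac)
    qed simp
    show "norm (dual_ract \<psi> a) \<le> norm \<psi> * norm a * 1"
    proof (rule *)
      fix x
      have "norm \<psi> * norm (a * x) \<le> norm \<psi> * (norm a * norm x)"
        by (intro mult_left_mono norm_mult_ineq norm_ge_zero)
      with b[of \<psi> "a * x"]
      show "cmod (cdual_apply (dual_ract \<psi> a) x) \<le> norm \<psi> * norm a * 1 * norm x"
        by (simp add: dual_ract_apply mult_ac)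
    qed simp
  qed
  show ?thesis
  proof
    show "\<exists>K. \<forall>a \<psi>. norm (dual_lact a \<psi> :: 'a cdual) \<le> norm a * norm \<psi> * K" using nl by blast
    show "\<exists>K. \<forall>\<psi> a. norm (dual_ract \<psi> a :: 'a cdual) \<le> norm \<psi> * norm a * K" using nr by blast
  qed (rule cdual_eqI, simp add: simps)+
qed


section \<open>Rank, compactness and weak compactness of linear maps\<close>

text \<open>The library's dimension is a natural number and takes the value 0 on every
  infinite-dimensional space, so infinite rank is treated separately.\<close>

definition complex_rank :: "('a::complex_vector \<Rightarrow> 'b::complex_vector) \<Rightarrow> enat"
  where "complex_rank T =
    (if \<exists>B. finite B \<and> range T \<subseteq> complex_vector.span B
     then enat (complex_vector.dim (range T)) else \<infinity>)"

definition compact_map :: "('a::complex_normed_vector \<Rightarrow> 'b::complex_normed_vector) \<Rightarrow> bool"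
  where "compact_map T \<longleftrightarrow> compact (closure (T ` cball 0 1))"

text \<open>The coarsest topology making all bounded complex-linear functionals continuous.\<close>

definition weak_topology :: "'a::complex_normed_vector topology"
  where "weak_topology = topology_generated_by {cdual_apply f -` U | f U. open U}"

definition weakly_compact_map :: "('a::complex_normed_vector \<Rightarrow> 'b::complex_normed_vector) \<Rightarrow> bool"
  where "weakly_compact_map T \<longleftrightarrow>
    compactin weak_topology (weak_topology closure_of (T ` cball 0 1))"

end

theory Submission
  imports Defs
begin

text \<open>
  Let \<open>D\<close> be a derivation from the commutative algebra \<open>A\<close> into a symmetric bimodule \<open>E\<close>. A functional
  \<open>\<psi>\<close> on \<open>E\<close> turns each \<open>x \<in> E\<close> into the functional \<open>a \<mapsto> \<psi> (a \<cdot> x)\<close> on \<open>A\<close>. Because \<open>E\<close> is symmetric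
  and \<open>A\<close> is commutative, this map \<open>E \<rightarrow> A\<^sup>*\<close> is a bounded bimodule homomorphism, so composing it with
  \<open>D\<close> gives a derivation into \<open>A\<^sup>*\<close> (\<open>derivation_orbit_functional\<close>). The composition has at most the
  rank of \<open>D\<close>, and is compact or weakly compact if \<open>D\<close> is, hence vanishes by hypothesis. As \<open>\<psi>\<close>
  is arbitrary, the Hahn--Banach theorem yields \<open>a \<cdot> D b = 0\<close> for all \<open>a\<close>, \<open>b\<close>.

  Therefore \<open>D\<close> kills all products, and so does \<open>\<phi> = \<psi> \<circ> D\<close>. Then \<open>a \<mapsto> \<phi> a \<cdot> \<phi>\<close> is a derivation
  into \<open>A\<^sup>*\<close>, trivially: both sides of the Leibniz rule are zero (\<open>derivation_rank_one\<close>). It is bounded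
  of rank at most one, so it is compact, and weakly compact; by hypothesis it vanishes
  (for \<open>n = 1\<close> in the first part, \<open>D = 0\<close> is immediate). So
  \<open>\<phi> = 0\<close> for every \<open>\<psi>\<close>, and \<open>D = 0\<close> by Hahn--Banach again (\<open>derivation_eq_zero\<close>).

  The Hahn--Banach theorem is needed in the weak form that bounded complex functionals separate
  points (\<open>cdual_separates\<close>). It is obtained from the fact that the minimal elements among the
  sublinear functionals below the norm are linear.
\<close>

section \<open>The Hahn--Banach theorem\<close>

text \<open>Homogeneity is required only as an inequality, since equality follows; this halves the
  work of verifying it for an infimum.\<close>

definition sublinear_below_norm :: "('a::real_normed_vector \<Rightarrow> real) \<Rightarrow> bool"
  where "sublinear_below_norm p \<longleftrightarrow>
    (\<forall>x y. p (x + y) \<le> p x + p y) \<and> (\<forall>r x. 0 \<le> r \<longrightarrow> p (r *\<^sub>R x) \<le> r * p x) \<and> (\<forall>x. p x \<le> norm x)"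

lemma sublinear_below_normD:
  assumes "sublinear_below_norm p"
  shows sublinear_add: "p (x + y) \<le> p x + p y"
    and sublinear_zero: "p 0 = 0"
    and sublinear_scale: "0 \<le> r \<Longrightarrow> p (r *\<^sub>R x) = r * p x"
    and sublinear_le_norm: "p x \<le> norm x"
    and sublinear_ge: "- p (- x) \<le> p x"
proof -
  have add: "p (x + y) \<le> p x + p y" and sc: "0 \<le> r \<Longrightarrow> p (r *\<^sub>R x) \<le> r * p x" for x y r
    using assms by (auto simp: sublinear_below_norm_def)
  show "p (x + y) \<le> p x + p y" by (rule add)
  show "p x \<le> norm x" using assms by (auto simp: sublinear_below_norm_def)
  show z: "p 0 = 0" using add[of 0 0] sc[of 0 0] by simp
  show "- p (- x) \<le> p x" using add[of x "- x"] z by simp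
  show "p (r *\<^sub>R x) = r * p x" if "0 \<le> r"
  proof (cases "r = 0")
    case False
    then have "r > 0" using that by simp
    then have "p x \<le> inverse r * p (r *\<^sub>R x)" using sc[of "inverse r" "r *\<^sub>R x"] by simp
    then have "r * p x \<le> p (r *\<^sub>R x)" using \<open>r > 0\<close> by (simp add: field_simps)
    with sc[OF that, of x] show ?thesis by simp
  qed (simp add: z)
qed

text \<open>The family need not be a chain: it is enough that for each instance of subadditivity or
  homogeneity some member of the family witnesses it. This covers the infimum of a chain in Zorn's
  lemma as well as the one-parameter family of the tilting construction below.\<close>

lemma sublinear_below_norm_INF:
  fixes f :: "'i \<Rightarrow> 'a::real_normed_vector \<Rightarrow> real"
  assumes ne: "I \<noteq> {}"
    and lower: "\<And>i x. i \<in> I \<Longrightarrow> b x \<le> f i x"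
    and add: "\<And>i j x y. i \<in> I \<Longrightarrow> j \<in> I \<Longrightarrow> \<exists>k\<in>I. f k (x + y) \<le> f i x + f j y"
    and scale: "\<And>i r x. i \<in> I \<Longrightarrow> 0 \<le> r \<Longrightarrow> \<exists>k\<in>I. f k (r *\<^sub>R x) \<le> r * f i x"
    and le_norm: "\<And>x. \<exists>k\<in>I. f k x \<le> norm x"
  shows "sublinear_below_norm (\<lambda>x. INF i\<in>I. f i x)"
proof -
  let ?q = "\<lambda>x. INF i\<in>I. f i x"
  have low: "?q x \<le> f i x" if "i \<in> I" for i x
    by (rule cINF_lower) (use that lower in \<open>auto intro!: bdd_belowI2\<close>)
  have "?q (x + y) \<le> ?q x + ?q y" for x y
  proof -
    have "?q (x + y) \<le> f i x + f j y" if "i \<in> I" "j \<in> I" for i j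
      using add[OF that, of x y] low[of _ "x + y"] by force
    then have "?q (x + y) - f j y \<le> ?q x" if "j \<in> I" for j
      using that by (intro cINF_greatest[OF ne]) (simp add: diff_le_eq)
    then have "?q (x + y) - ?q x \<le> ?q y"
      by (intro cINF_greatest[OF ne]) (simp add: algebra_simps)
    then show ?thesis by simp
  qed
  moreover have "?q (r *\<^sub>R x) \<le> r * ?q x" if "0 \<le> r" for r x
  proof -
    have *: "?q (r *\<^sub>R x) \<le> r * f i x" if "i \<in> I" for i
      using scale[OF that \<open>0 \<le> r\<close>, of x] low[of _ "r *\<^sub>R x"] by force
    show ?thesis
    proof (cases "r = 0")
      case True
      with * ne show ?thesis by auto
    next
      case False
      with that have "r > 0" by simp
      then have "?q (r *\<^sub>R x) / r \<le> ?q x"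
        using * by (intro cINF_greatest[OF ne]) (simp add: field_simps)
      then show ?thesis using \<open>r > 0\<close> by (simp add: field_simps)
    qed
  qed
  moreover have "?q x \<le> norm x" for x
    using le_norm[of x] low[of _ x] by force
  ultimately show ?thesis by (auto simp: sublinear_below_norm_def)
qed

text \<open>The new functional is the infimum over \<open>t \<ge> 0\<close> of \<open>p (x + t y) - t p y\<close>. It satisfies
  \<open>q (- y) = - q y\<close>, so it has become linear along the line through \<open>y\<close>. This one construction
  is used twice: applied to the norm with \<open>y \<noteq> 0\<close>, it forces every sublinear functional below it to be negative
  at \<open>- y\<close>; applied to a minimal functional, which it cannot lower, it gives additivity.\<close>

lemma sublinear_below_norm_tilt:
  assumes p: "sublinear_below_norm p"
  obtains q where "sublinear_below_norm q" "q \<le> p" "\<And>x. q x \<le> p (x + y) - p y"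
proof
  let ?f = "\<lambda>t x. p (x + t *\<^sub>R y) - t * p y"
  let ?q = "\<lambda>x. INF t\<in>{0..}. ?f t x"
  have lower: "- p (- x) \<le> ?f t x" if "t \<in> {0..}" for t x
  proof -
    have "t * p y = p ((x + t *\<^sub>R y) + - x)" using that by (simp add: sublinear_scale[OF p])
    also have "\<dots> \<le> p (x + t *\<^sub>R y) + p (- x)" by (rule sublinear_add[OF p])
    finally show ?thesis by simp
  qed
  have low: "?q x \<le> ?f t x" if "t \<in> {0..}" for t x
    by (rule cINF_lower) (use that lower in \<open>auto intro!: bdd_belowI2\<close>)
  show "sublinear_below_norm ?q"
  proof (rule sublinear_below_norm_INF[where b = "\<lambda>x. - p (- x)"])
    show "- p (- x) \<le> ?f t x" if "t \<in> {0..}" for t x by (rule lower[OF that])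
    show "\<exists>k\<in>{0..}. ?f k (x + z) \<le> ?f s x + ?f t z" if "s \<in> {0..}" "t \<in> {0..}" for s t x z
    proof (rule bexI)
      show "?f (s + t) (x + z) \<le> ?f s x + ?f t z"
        using sublinear_add[OF p, of "x + s *\<^sub>R y" "z + t *\<^sub>R y"] by (simp add: algebra_simps)
    qed (use that in simp)
    show "\<exists>k\<in>{0..}. ?f k (r *\<^sub>R x) \<le> r * ?f t x" if "t \<in> {0..}" "0 \<le> r" for t r x
    proof (rule bexI)
      show "?f (r * t) (r *\<^sub>R x) \<le> r * ?f t x"
        using sublinear_scale[OF p \<open>0 \<le> r\<close>, of "x + t *\<^sub>R y"] by (simp add: algebra_simps)
    qed (use that in simp)
    show "\<exists>k\<in>{0..}. ?f k x \<le> norm x" for x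
      by (rule bexI[of _ 0]) (use sublinear_le_norm[OF p] in auto)
  qed simp
  show "?q \<le> p" using low[of 0] by (auto simp: le_fun_def)
  show "?q x \<le> p (x + y) - p y" for x using low[of 1 x] by simp
qed

text \<open>Zorn's lemma for the reversed pointwise order. The infimum of a chain is finite because
  \<open>p x \<ge> - p (- x) \<ge> - norm x\<close> for every sublinear functional \<open>p\<close> below the norm.\<close>

lemma ex_minimal_sublinear_below_norm:
  assumes q: "sublinear_below_norm q"
  obtains m where "sublinear_below_norm m" "m \<le> q"
    "\<And>p. sublinear_below_norm p \<Longrightarrow> p \<le> m \<Longrightarrow> p = m"
proof -
  let ?A = "{p. sublinear_below_norm p \<and> p \<le> q}"
  let ?P = "\<lambda>p p' :: 'a \<Rightarrow> real. p' \<le> p"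
  have "\<exists>m\<in>?A. \<forall>p\<in>?A. ?P m p \<longrightarrow> p = m"
  proof (rule predicate_Zorn)
    show "partial_order_on ?A (relation_of ?P ?A)"
      by (auto simp: partial_order_on_def preorder_on_def relation_of_def
          refl_on_def trans_def antisym_def)
    fix C assume C: "C \<in> Chains (relation_of ?P ?A)"
    have CA: "p \<in> ?A" if "p \<in> C" for p
      using that C unfolding Chains_def relation_of_def by auto
    have lin: "p \<le> p' \<or> p' \<le> p" if "p \<in> C" "p' \<in> C" for p p'
      using that C unfolding Chains_def relation_of_def by auto
    show "\<exists>u\<in>?A. \<forall>p\<in>C. ?P p u"
    proof (cases "C = {}")
      case True
      then show ?thesis using q by auto
    next
      case False
      let ?u = "\<lambda>x. INF p\<in>C. p x"
      have lower: "- norm x \<le> p x" if "p \<in> C" for p x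
        using CA[OF that] sublinear_ge[of p x] sublinear_le_norm[of p "- x"] by auto
      have low: "?u x \<le> p x" if "p \<in> C" for p x
        by (rule cINF_lower) (use that lower in \<open>auto intro!: bdd_belowI2\<close>)
      have "sublinear_below_norm ?u"
      proof (rule sublinear_below_norm_INF[OF False lower])
        fix p p' x y assume pp: "p \<in> C" "p' \<in> C"
        have "p (x + y) \<le> p x + p y" "p' (x + y) \<le> p' x + p' y"
          using CA[OF pp(1)] CA[OF pp(2)] sublinear_add by auto
        then show "\<exists>k\<in>C. k (x + y) \<le> p x + p' y"
          using lin[OF pp] pp le_funD[of p p' y] le_funD[of p' p x]
          by (metis add_left_mono add_right_mono order_trans)
      next
        fix p r x assume "p \<in> C" "0 \<le> (r::real)"
        then show "\<exists>k\<in>C. k (r *\<^sub>R x) \<le> r * p x"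
          using CA[of p] sublinear_scale[of p r x] by (auto intro!: bexI[of _ p])
      next
        fix x show "\<exists>k\<in>C. k x \<le> norm x" using False CA sublinear_le_norm by blast
      qed
      moreover have "?u \<le> q"
        using False CA low by (fastforce simp: le_fun_def intro: order_trans)
      ultimately have "?u \<in> ?A" by simp
      moreover have "\<forall>p\<in>C. ?P p ?u" using low by (simp add: le_fun_def)
      ultimately show ?thesis by blast
    qed
  qed
  then obtain m where m: "m \<in> ?A" "\<And>p. p \<in> ?A \<Longrightarrow> p \<le> m \<Longrightarrow> p = m" by blast
  show ?thesis
  proof (rule that)
    show "p = m" if "sublinear_below_norm p" "p \<le> m" for p
      by (rule m(2)) (use that m(1) in \<open>auto intro: order_trans\<close>)
  qed (use m(1) in auto)
qed

lemma minimal_sublinear_linear: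
  assumes m: "sublinear_below_norm m"
    and min: "\<And>p. sublinear_below_norm p \<Longrightarrow> p \<le> m \<Longrightarrow> p = m"
  shows "bounded_linear m"
proof -
  have add: "m (x + y) = m x + m y" for x y
  proof -
    obtain q where q: "sublinear_below_norm q" "q \<le> m" "\<And>x. q x \<le> m (x + y) - m y"
      using sublinear_below_norm_tilt[OF m] by blast
    \<comment> \<open>Minimality gives \<open>q = m\<close>, and the bound on \<open>q\<close> becomes superadditivity of \<open>m\<close>.\<close>
    have "m x \<le> m (x + y) - m y" using q(3)[of x] min[OF q(1,2)] by simp
    with sublinear_add[OF m, of x y] show ?thesis by simp
  qed
  have neg: "m (- x) = - m x" for x
    using add[of x "- x"] sublinear_zero[OF m] by simp
  have abs: "\<bar>m x\<bar> \<le> norm x" for x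
    using sublinear_le_norm[OF m, of x] sublinear_le_norm[OF m, of "- x"] neg[of x] by auto
  have "m (r *\<^sub>R x) = r *\<^sub>R m x" for r x
    using sublinear_scale[OF m, of r x] sublinear_scale[OF m, of "- r" x] neg[of "r *\<^sub>R x"]
    by (cases "0 \<le> r") auto
  then show ?thesis
    using add abs by (intro bounded_linear_intro[where K = 1]) auto
qed

lemma ex_bounded_linear_nonzero:
  fixes y :: "'a::real_normed_vector"
  assumes "y \<noteq> 0"
  obtains u :: "'a \<Rightarrow> real" where "bounded_linear u" "u y \<noteq> 0"
proof -
  have "sublinear_below_norm (norm :: 'a \<Rightarrow> real)"
    by (simp add: sublinear_below_norm_def norm_triangle_ineq)
  then obtain q where q: "sublinear_below_norm q" "\<And>x. q x \<le> norm (x + y) - norm y"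
    using sublinear_below_norm_tilt by metis
  then obtain m where m: "sublinear_below_norm m" "m \<le> q"
      "\<And>p. sublinear_below_norm p \<Longrightarrow> p \<le> m \<Longrightarrow> p = m"
    using ex_minimal_sublinear_below_norm by metis
  have "bounded_linear m" by (rule minimal_sublinear_linear[OF m(1,3)])
  moreover have "m (- y) < 0"
  proof -
    have "m (- y) \<le> - norm y" using le_funD[OF m(2), of "- y"] q(2)[of "- y"] by simp
    also have "\<dots> < 0" using assms by simp
    finally show ?thesis .
  qed
  then have "m y \<noteq> 0"
    using linear_neg[OF bounded_linear.linear[OF \<open>bounded_linear m\<close>], of y] by auto
  ultimately show ?thesis by (rule that)
qed

definition cdual_of :: "('a::complex_normed_vector \<Rightarrow> complex) \<Rightarrow> 'a cdual"
  where "cdual_of f = Abs_cdual (Blinfun f)"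

lemma cdual_apply_cdual_of:
  assumes "bounded_linear f" "\<And>c x. f (c *\<^sub>C x) = c * f x"
  shows "cdual_apply (cdual_of f) x = f x"
  unfolding cdual_apply.rep_eq cdual_of_def
  using assms by (subst Abs_cdual_inverse) (auto simp: bounded_linear_Blinfun_apply)

lemma bounded_linear_scaleC:
  "bounded_linear (scaleC c :: 'a::complex_normed_vector \<Rightarrow> 'a)"
  by (rule bounded_linear_intro[where K = "cmod c"])
    (simp_all add: scaleC_add_right scaleR_scaleC scaleC_scaleC norm_scaleC mult.commute)

text \<open>A real functional \<open>u\<close> is the real part of the complex functional
  \<open>x \<mapsto> u x - \<i> u (\<i> x)\<close>.\<close>

lemma cdual_separates:
  fixes y :: "'a::complex_normed_vector"
  assumes "\<And>f :: 'a cdual. cdual_apply f y = 0"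
  shows "y = 0"
proof (rule ccontr)
  assume "y \<noteq> 0"
  then obtain u :: "'a \<Rightarrow> real" where u: "bounded_linear u" "u y \<noteq> 0"
    by (rule ex_bounded_linear_nonzero)
  interpret u: bounded_linear u by (rule u(1))
  let ?f = "\<lambda>x. complex_of_real (u x) - \<i> * complex_of_real (u (\<i> *\<^sub>C x))"
  have bl: "bounded_linear ?f"
    by (intro bounded_linear_sub bounded_linear_const_mult
        bounded_linear_compose[OF bounded_linear_of_real]
        bounded_linear_compose[OF u(1)] u(1) bounded_linear_scaleC)
  have re: "u (complex_of_real r *\<^sub>C x) = r * u x" for r x
    using u.scaleR[of r x] by (simp add: scaleR_scaleC)
  have "?f (c *\<^sub>C x) = c * ?f x" for c x
  proof -
    have 1: "c *\<^sub>C x = complex_of_real (Re c) *\<^sub>C x + complex_of_real (Im c) *\<^sub>C \<i> *\<^sub>C x"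
      using complex_eq[of c]
      by (simp add: scaleC_scaleC scaleC_add_left[symmetric] mult.commute)
    have 2: "\<i> *\<^sub>C c *\<^sub>C x = complex_of_real (Re c) *\<^sub>C \<i> *\<^sub>C x + complex_of_real (- Im c) *\<^sub>C x"
    proof -
      have "\<i> * c = complex_of_real (Re c) * \<i> + complex_of_real (- Im c)"
        by (simp add: complex_eq_iff)
      then show ?thesis by (simp only: scaleC_scaleC scaleC_add_left[symmetric])
    qed
    have "u (c *\<^sub>C x) = Re c * u x + Im c * u (\<i> *\<^sub>C x)"
      unfolding 1 by (simp only: u.add re)
    moreover have "u (\<i> *\<^sub>C c *\<^sub>C x) = Re c * u (\<i> *\<^sub>C x) - Im c * u x"
      using 2 re[of "- Im c" x] by (simp only: u.add re)
    ultimately show ?thesis by (simp add: complex_eq_iff)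
  qed
  then have "cdual_apply (cdual_of ?f) y = ?f y" by (rule cdual_apply_cdual_of[OF bl])
  then have "?f y = 0" using assms by metis
  then have "u y = 0" by (simp add: complex_eq_iff)
  with u(2) show False ..
qed


section \<open>The weak topology\<close>

lemma topspace_weak_topology [simp]: "topspace weak_topology = UNIV"
proof -
  have "(UNIV :: 'a set) \<in> {cdual_apply f -` U | f U. open U}"
    by (auto intro!: exI[of _ UNIV])
  then show ?thesis unfolding weak_topology_def topology_generated_by_topspace by blast
qed

lemma openin_weak_topology_vimage: "open U \<Longrightarrow> openin weak_topology (cdual_apply f -` U)"
  unfolding weak_topology_def by (rule topology_generated_by_Basis) auto

lemma continuous_map_weak_topology_cdual: "continuous_map weak_topology euclidean (cdual_apply f)"
  using openin_weak_topology_vimage by (auto simp: continuous_map_alt)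

lemma continuous_map_into_weak_topology:
  assumes "\<And>f. continuous_map X euclidean (\<lambda>x. cdual_apply f (g x))"
  shows "continuous_map X (weak_topology :: 'b::complex_normed_vector topology) g"
  unfolding weak_topology_def
proof (rule continuous_on_generated_topo)
  fix V :: "'b set" assume "V \<in> {cdual_apply f -` U | f U. open U}"
  then obtain f U where "V = cdual_apply f -` U" "open U" by blast
  then show "openin X (g -` V \<inter> topspace X)"
    using assms[of f] by (auto simp: continuous_map_alt vimage_def)
next
  show "g ` topspace X \<subseteq> \<Union> {cdual_apply f -` U | f U. open U}"
    using topspace_weak_topology unfolding weak_topology_def by auto
qed

lemma Hausdorff_space_weak_topology: "Hausdorff_space weak_topology"
  unfolding Hausdorff_space_def
proof (intro allI impI)
  fix x y :: 'a assume "x \<in> topspace weak_topology \<and> y \<in> topspace weak_topology \<and> x \<noteq> y"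
  then have "x - y \<noteq> 0" by simp
  then obtain f where "cdual_apply f (x - y) \<noteq> 0" using cdual_separates by blast
  then have "cdual_apply f x \<noteq> cdual_apply f y"
    using bounded_linear_cdual_apply[of f] by (simp add: bounded_linear.linear linear_diff)
  then obtain U V where "open U" "open V" "cdual_apply f x \<in> U" "cdual_apply f y \<in> V" "U \<inter> V = {}"
    using hausdorff by meson
  then show "\<exists>U V. openin weak_topology U \<and> openin weak_topology V \<and> x \<in> U \<and> y \<in> V \<and> disjnt U V"
    using openin_weak_topology_vimage
    by (intro exI[of _ "cdual_apply f -` U"] exI[of _ "cdual_apply f -` V"]) (auto simp: disjnt_def)
qed

lemma compactin_closure_of_subset:
  assumes "Hausdorff_space X" "compactin X K" "S \<subseteq> K"
  shows "compactin X (X closure_of S)"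
  using assms by (meson closed_compactin closedin_closure_of closure_of_minimal compactin_imp_closedin)


section \<open>Compact and weakly compact maps\<close>

lemma compact_map_subset:
  "compact K \<Longrightarrow> T ` cball 0 1 \<subseteq> K \<Longrightarrow> compact_map T"
  using compactin_closure_of_subset[OF Hausdorff_space_euclidean, of K]
  by (simp add: compact_map_def)

lemma weakly_compact_map_subset:
  "compactin weak_topology K \<Longrightarrow> T ` cball 0 1 \<subseteq> K \<Longrightarrow> weakly_compact_map T"
  unfolding weakly_compact_map_def
  by (rule compactin_closure_of_subset[OF Hausdorff_space_weak_topology])

lemma image_subset_weak_closure: "T ` S \<subseteq> weak_topology closure_of (T ` S)"
  by (rule closure_of_subset) simp

lemma compact_map_compose:
  assumes R: "bounded_linear R" and D: "compact_map D"
  shows "compact_map (\<lambda>a. R (D a))"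
proof (rule compact_map_subset)
  show "compact (R ` closure (D ` cball 0 1))"
    using D by (intro compact_continuous_image linear_continuous_on R) (simp add: compact_map_def)
  show "(\<lambda>a. R (D a)) ` cball 0 1 \<subseteq> R ` closure (D ` cball 0 1)"
    using closure_subset[of "D ` cball 0 1"] by auto
qed

lemma weakly_compact_map_compose:
  assumes R: "bounded_linear R" "\<And>c x. R (c *\<^sub>C x) = c *\<^sub>C R x" and D: "weakly_compact_map D"
  shows "weakly_compact_map (\<lambda>a. R (D a))"
proof (rule weakly_compact_map_subset)
  have "continuous_map weak_topology weak_topology R"
  proof (rule continuous_map_into_weak_topology)
    fix f
    have eq: "(\<lambda>x. cdual_apply f (R x)) = cdual_apply (cdual_of (\<lambda>x. cdual_apply f (R x)))"
      by (intro ext cdual_apply_cdual_of[symmetric])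
        (simp_all add: R cdual_apply_scaleC bounded_linear_compose[OF bounded_linear_cdual_apply])
    show "continuous_map weak_topology euclidean (\<lambda>x. cdual_apply f (R x))"
      by (subst eq) (rule continuous_map_weak_topology_cdual)
  qed
  then show "compactin weak_topology (R ` (weak_topology closure_of (D ` cball 0 1)))"
    using D by (intro image_compactin) (simp add: weakly_compact_map_def)
  show "(\<lambda>a. R (D a)) ` cball 0 1 \<subseteq> R ` (weak_topology closure_of (D ` cball 0 1))"
    using image_subset_weak_closure[of D "cball 0 1"] by auto
qed

lemma compact_map_imp_weakly_compact_map:
  assumes "compact_map T"
  shows "weakly_compact_map T"
proof (rule weakly_compact_map_subset)
  have "continuous_map euclidean weak_topology (\<lambda>x. x)"
    by (rule continuous_map_into_weak_topology)
      (simp add: linear_continuous_on bounded_linear_cdual_apply)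
  from image_compactin[OF _ this, of "closure (T ` cball 0 1)"]
  show "compactin weak_topology (closure (T ` cball 0 1))"
    using assms by (simp add: compact_map_def)
qed (rule closure_subset)

lemma bounded_linear_if_bounded_on_cball:
  fixes g :: "'a::real_normed_vector \<Rightarrow> 'b::real_normed_vector"
  assumes g: "linear g" and K: "\<And>a. norm a \<le> 1 \<Longrightarrow> norm (g a) \<le> K"
  shows "bounded_linear g"
proof (rule bounded_linear_intro[where K = K])
  fix a
  show "norm (g a) \<le> norm a * K"
  proof (cases "a = 0")
    case False
    then show ?thesis
      using K[of "inverse (norm a) *\<^sub>R a"] by (simp add: linear_scale[OF g] field_simps)
  qed (simp add: linear_0[OF g])
qed (simp_all add: linear_add[OF g] linear_scale[OF g])

lemma complex_linear_imp_linear: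
  fixes T :: "'a::complex_vector \<Rightarrow> 'b::complex_vector"
  shows "Vector_Spaces.linear scaleC scaleC T \<Longrightarrow> linear T"
  by (auto simp: Vector_Spaces.linear_iff linear_iff scaleR_scaleC)

text \<open>The functional \<open>f\<close> is weakly continuous, so it maps the
  weakly compact closure of \<open>T ` cball 0 1\<close> to a compact, hence bounded, set of scalars.\<close>

lemma weakly_compact_map_bounded_linear_cdual:
  assumes T: "weakly_compact_map T" and lin: "linear T"
  shows "bounded_linear (\<lambda>a. cdual_apply f (T a))"
proof -
  let ?K = "weak_topology closure_of (T ` cball 0 1)"
  have "compact (cdual_apply f ` ?K)"
    using image_compactin[OF _ continuous_map_weak_topology_cdual, of ?K f] T
    by (simp add: weakly_compact_map_def)
  then have "bounded (cdual_apply f ` ?K)" by (rule compact_imp_bounded)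
  then obtain B where B: "\<forall>z\<in>cdual_apply f ` ?K. norm z \<le> B" unfolding bounded_iff ..
  have norm_le: "norm (cdual_apply f (T a)) \<le> B" if "norm a \<le> 1" for a
  proof -
    have "T a \<in> T ` cball 0 1" using that by simp
    then have "T a \<in> ?K" by (rule subsetD[OF image_subset_weak_closure])
    then show ?thesis by (rule bspec[OF B imageI])
  qed
  have "linear (\<lambda>a. cdual_apply f (T a))"
    using linear_compose[OF lin bounded_linear.linear[OF bounded_linear_cdual_apply]]
    by (simp add: o_def)
  then show ?thesis using norm_le by (rule bounded_linear_if_bounded_on_cball)
qed

lemma bounded_linear_scaleC_left: "bounded_linear (\<lambda>c. c *\<^sub>C (v :: 'a::complex_normed_vector))"
  by (rule bounded_linear_intro[where K = "norm v"])
    (simp_all add: scaleC_add_left scaleR_scaleC scaleC_scaleC norm_scaleC scaleR_conv_of_real)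

lemma compact_map_rank_one:
  fixes v :: "'b::complex_normed_vector"
  shows "compact_map (\<lambda>a. cdual_apply \<phi> a *\<^sub>C v)"
proof -
  obtain K where K: "K > 0" "\<And>a. norm (cdual_apply \<phi> a) \<le> norm a * K"
    using bounded_linear.pos_bounded[OF bounded_linear_cdual_apply, of \<phi>] by blast
  have "compact ((\<lambda>c. c *\<^sub>C v) ` cball 0 K)"
    by (intro compact_continuous_image linear_continuous_on bounded_linear_scaleC_left compact_cball)
  moreover
  have "norm (cdual_apply \<phi> a) \<le> K" if "norm a \<le> 1" for a
    using order_trans[OF K(2)[of a] mult_right_mono[OF that, of K]] K(1) by simp
  then have "(\<lambda>a. cdual_apply \<phi> a *\<^sub>C v) ` cball 0 1 \<subseteq> (\<lambda>c. c *\<^sub>C v) ` cball 0 K" by auto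
  ultimately show ?thesis by (rule compact_map_subset)
qed


section \<open>Rank\<close>

text \<open>A spanning set whose cardinality is controlled, as opposed to the arbitrary finite one in
  the definition of the rank, is what can be transported along a linear map.\<close>

lemma complex_rank_finite_basis:
  assumes "complex_rank T < enat n"
  obtains B where "finite B" "range T \<subseteq> complex_vector.span B" "card B < n"
proof -
  from assms obtain B0 where B0: "finite B0" "range T \<subseteq> complex_vector.span B0"
    and n: "complex_vector.dim (range T) < n"
    by (auto simp: complex_rank_def split: if_splits)
  obtain B where B: "B \<subseteq> range T" "complex_vector.independent B"
      "range T \<subseteq> complex_vector.span B" "card B = complex_vector.dim (range T)"
    by (rule complex_vector.basis_exists)
  have "finite B" using complex_vector.independent_span_bound[OF B0(1) B(2)] B(1) B0(2) by blast
  with B n show ?thesis by (intro that) auto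
qed

lemma complex_rank_le_card:
  assumes "finite B" "range T \<subseteq> complex_vector.span B"
  shows "complex_rank T \<le> enat (card B)"
  using assms complex_vector.dim_le_card[OF assms(2,1)] by (auto simp: complex_rank_def)

lemma complex_rank_compose_less:
  assumes R: "Vector_Spaces.linear scaleC scaleC R" and D: "complex_rank D < enat n"
  shows "complex_rank (\<lambda>a. R (D a)) < enat n"
proof -
  obtain B where B: "finite B" "range D \<subseteq> complex_vector.span B" "card B < n"
    using complex_rank_finite_basis[OF D] by blast
  interpret R: Vector_Spaces.linear scaleC scaleC R by (rule R)
  have "range (\<lambda>a. R (D a)) \<subseteq> complex_vector.span (R ` B)"
    using B(2) by (auto simp: R.span_image)
  then have "complex_rank (\<lambda>a. R (D a)) \<le> enat (card (R ` B))"
    using B(1) by (intro complex_rank_le_card) auto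
  also have "\<dots> < enat n" using card_image_le[OF B(1), of R] B(3) by simp
  finally show ?thesis .
qed

lemma complex_rank_less_one:
  assumes "complex_rank T < enat 1"
  shows "T = (\<lambda>_. 0)"
proof -
  obtain B where "finite B" "range T \<subseteq> complex_vector.span B" "card B < 1"
    by (rule complex_rank_finite_basis[OF assms])
  then have "range T \<subseteq> {0}" by simp
  then show ?thesis by (auto simp: fun_eq_iff)
qed

lemma complex_rank_rank_one: "complex_rank (\<lambda>a. f a *\<^sub>C v) \<le> enat 1"
proof -
  have "range (\<lambda>a. f a *\<^sub>C v) \<subseteq> complex_vector.span {v}"
    by (auto intro: complex_vector.span_base complex_vector.span_scale)
  from complex_rank_le_card[OF _ this] show ?thesis by simp
qed


section \<open>Derivations into symmetric bimodules\<close>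

definition orbit_functional ::
  "('a::complex_banach_algebra \<Rightarrow> 'e::complex_banach \<Rightarrow> 'e) \<Rightarrow> 'e cdual \<Rightarrow> 'e \<Rightarrow> 'a cdual"
  where "orbit_functional lact \<psi> x = cdual_of (\<lambda>a. cdual_apply \<psi> (lact a x))"

context banach_bimodule
begin

lemma orbit_functional_apply:
  "cdual_apply (orbit_functional (\<rhd>) \<psi> x) a = cdual_apply \<psi> (a \<rhd> x)"
  unfolding orbit_functional_def
  by (rule cdual_apply_cdual_of)
    (simp_all add: lact_scaleC_left cdual_apply_scaleC
      bounded_linear_compose[OF bounded_linear_cdual_apply]
      bounded_bilinear.bounded_linear_left[OF bounded_bilinear_lact])

lemma orbit_functional_scaleC:
  "orbit_functional (\<rhd>) \<psi> (c *\<^sub>C x) = c *\<^sub>C orbit_functional (\<rhd>) \<psi> x"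
  by (rule cdual_eqI) (simp add: orbit_functional_apply lact_scaleC_right cdual_apply_scaleC)

lemma bounded_linear_orbit_functional: "bounded_linear (orbit_functional (\<rhd>) \<psi>)"
proof -
  interpret l: bounded_bilinear "(\<rhd>)" by (rule bounded_bilinear_lact)
  interpret f: bounded_linear "cdual_apply \<psi>" by (rule bounded_linear_cdual_apply)
  obtain K where K: "K > 0" "\<And>x. norm (cdual_apply \<psi> x) \<le> norm x * K"
    using f.pos_bounded by blast
  obtain L where L: "L > 0" "\<And>a x. norm (a \<rhd> x) \<le> norm a * norm x * L"
    using l.pos_bounded by blast
  show ?thesis
  proof (rule bounded_linear_intro[where K = "L * K"])
    fix x
    have "norm (cdual_apply (orbit_functional (\<rhd>) \<psi> x) a) \<le> norm x * (L * K) * norm a" for a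
      using order_trans[OF K(2)[of "a \<rhd> x"] mult_right_mono[OF L(2)[of a x], of K]] K(1)
      by (simp add: orbit_functional_apply mult_ac)
    then show "norm (orbit_functional (\<rhd>) \<psi> x) \<le> norm x * (L * K)"
      unfolding norm_cdual_eq_onorm using K(1) L(1) by (intro onorm_bound) auto
  qed (rule cdual_eqI, simp add: orbit_functional_apply l.add_right l.scaleR_right f.add f.scaleR)+
qed

lemma linear_orbit_functional: "Vector_Spaces.linear scaleC scaleC (orbit_functional (\<rhd>) \<psi>)"
  using linear_add[OF bounded_linear.linear[OF bounded_linear_orbit_functional]]
  by (simp add: Vector_Spaces.linear_iff complex_vector.vector_space_axioms orbit_functional_scaleC)

end

text \<open>Composition of a derivation with a bimodule homomorphism. Evaluated at \<open>x\<close>, the Leibniz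
  rule reads \<open>\<psi> (x \<cdot> D (a b)) = \<psi> ((x a) \<cdot> D b) + \<psi> ((b x) \<cdot> D a)\<close>; symmetry of \<open>E\<close> moves \<open>b\<close> to the
  left of \<open>D a\<close>, and commutativity of \<open>A\<close> identifies \<open>x b\<close> with \<open>b x\<close>.\<close>

lemma derivation_orbit_functional:
  fixes lact :: "'a::{complex_banach_algebra, comm_ring} \<Rightarrow> 'e::complex_banach \<Rightarrow> 'e"
  assumes E: "symmetric_banach_bimodule lact ract" and D: "derivation lact ract D"
  shows "derivation dual_lact dual_ract (\<lambda>a. orbit_functional lact \<psi> (D a))"
proof -
  interpret symmetric_banach_bimodule lact ract by (rule E)
  interpret f: bounded_linear "cdual_apply \<psi>" by (rule bounded_linear_cdual_apply)
  interpret l: bounded_bilinear lact by (rule bounded_bilinear_lact)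
  have "Vector_Spaces.linear scaleC scaleC (\<lambda>a. orbit_functional lact \<psi> (D a))"
    using D linear_orbit_functional[of \<psi>]
    by (auto simp: derivation_def Vector_Spaces.linear_iff)
  moreover have "orbit_functional lact \<psi> (D (a * b)) =
      dual_lact a (orbit_functional lact \<psi> (D b)) + dual_ract (orbit_functional lact \<psi> (D a)) b"
    for a b
  proof (rule cdual_eqI)
    fix x
    have "D (a * b) = lact a (D b) + lact b (D a)"
      using D by (simp add: derivation_def symmetric)
    then show "cdual_apply (orbit_functional lact \<psi> (D (a * b))) x =
      cdual_apply (dual_lact a (orbit_functional lact \<psi> (D b)) +
        dual_ract (orbit_functional lact \<psi> (D a)) b) x"
      by (simp add: orbit_functional_apply dual_lact_apply dual_ract_apply
          l.add_right f.add lact_lact mult.commute[of b x])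
  qed
  ultimately show ?thesis by (simp add: derivation_def)
qed

text \<open>Both module actions annihilate a functional that vanishes on products, so every term of
  the Leibniz rule is zero.\<close>

lemma derivation_rank_one:
  assumes "\<And>a b. cdual_apply \<phi> (a * b) = 0"
  shows "derivation dual_lact dual_ract (\<lambda>a. cdual_apply \<phi> a *\<^sub>C \<phi>)"
proof -
  have "linear (cdual_apply \<phi>)" using bounded_linear.linear[OF bounded_linear_cdual_apply] .
  then have "Vector_Spaces.linear scaleC scaleC (\<lambda>a. cdual_apply \<phi> a *\<^sub>C \<phi>)"
    by (simp add: Vector_Spaces.linear_iff complex_vector.vector_space_axioms linear_add
        scaleC_add_left scaleC_scaleC cdual_apply_scaleC)
  moreover have "dual_lact a (c *\<^sub>C \<phi>) = 0" "dual_ract (c *\<^sub>C \<phi>) a = 0" for a c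
    by (rule cdual_eqI, simp add: dual_lact_apply dual_ract_apply assms)+
  ultimately show ?thesis by (simp add: derivation_def assms)
qed

text \<open>The argument common to all three parts. The hypotheses \<open>orbit\<close> and \<open>rank_one\<close> isolate the
  two kinds of derivations into \<open>A\<^sup>*\<close> to which the assumption on \<open>A\<close> is applied; continuity of \<open>D\<close> is
  asked for only against functionals, the form in which weak compactness provides it directly.\<close>

lemma derivation_eq_zero:
  fixes lact :: "'a::{complex_banach_algebra, comm_ring} \<Rightarrow> 'e::complex_banach \<Rightarrow> 'e"
  assumes E: "symmetric_banach_bimodule lact ract" and D: "derivation lact ract D"
    and bdd: "\<And>\<psi>. bounded_linear (\<lambda>a. cdual_apply \<psi> (D a))"
    and orbit: "\<And>\<psi>. (\<lambda>a. orbit_functional lact \<psi> (D a)) = (\<lambda>_. 0)"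
    and rank_one: "\<And>\<phi> :: 'a cdual. derivation dual_lact dual_ract (\<lambda>a. cdual_apply \<phi> a *\<^sub>C \<phi>) \<Longrightarrow>
      (\<lambda>a. cdual_apply \<phi> a *\<^sub>C \<phi>) = (\<lambda>_. 0)"
  shows "D = (\<lambda>_. 0)"
proof
  fix b
  interpret symmetric_banach_bimodule lact ract by (rule E)
  have "lact a (D c) = 0" for a c
  proof (rule cdual_separates)
    fix \<psi>
    show "cdual_apply \<psi> (lact a (D c)) = 0"
      using fun_cong[OF orbit, of \<psi> c] orbit_functional_apply[of \<psi> "D c" a] by simp
  qed
  then have mult: "D (a * c) = 0" for a c
    using D by (simp add: derivation_def symmetric[symmetric])
  show "D b = 0"
  proof (rule cdual_separates)
    fix \<psi>
    define \<phi> where "\<phi> = cdual_of (\<lambda>a. cdual_apply \<psi> (D a))"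
    have \<phi>: "cdual_apply \<phi> a = cdual_apply \<psi> (D a)" for a
      unfolding \<phi>_def
      by (rule cdual_apply_cdual_of[OF bdd])
        (use D in \<open>simp add: derivation_def Vector_Spaces.linear_iff cdual_apply_scaleC\<close>)
    have "cdual_apply \<phi> (a * c) = 0" for a c
      using mult[of a c] linear_0[OF bounded_linear.linear[OF bounded_linear_cdual_apply]]
      by (simp add: \<phi>)
    then have "(\<lambda>a. cdual_apply \<phi> a *\<^sub>C \<phi>) = (\<lambda>_. 0)" by (intro rank_one derivation_rank_one)
    \<comment> \<open>Evaluating at \<open>b\<close> twice gives \<open>(\<phi> b)\<^sup>2 = 0\<close>.\<close>
    then have "cdual_apply (cdual_apply \<phi> b *\<^sub>C \<phi>) b = cdual_apply 0 b" by metis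
    then show "cdual_apply \<psi> (D b) = 0" by (simp add: \<phi>)
  qed
qed

theorem theorem2p3:
  shows
    "(\<forall>n::nat. n \<ge> 1 \<longrightarrow>
        (\<forall>D :: 'a::{complex_banach_algebra, comm_ring} \<Rightarrow> 'a cdual.
            derivation dual_lact dual_ract D \<and> bounded_linear D \<and> complex_rank D < enat n
            \<longrightarrow> D = (\<lambda>_. 0)) \<longrightarrow>
        (\<forall>(lact :: 'a \<Rightarrow> 'e::complex_banach \<Rightarrow> 'e) ract.
            symmetric_banach_bimodule lact ract \<longrightarrow>
            (\<forall>D. derivation lact ract D \<and> bounded_linear D \<and> complex_rank D < enat n
               \<longrightarrow> D = (\<lambda>_. 0))))
     \<and>
     ((\<forall>D :: 'a \<Rightarrow> 'a cdual.
          derivation dual_lact dual_ract D \<and> compact_map D \<longrightarrow> D = (\<lambda>_. 0)) \<longrightarrow>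
        (\<forall>(lact :: 'a \<Rightarrow> 'e \<Rightarrow> 'e) ract.
            symmetric_banach_bimodule lact ract \<longrightarrow>
            (\<forall>D. derivation lact ract D \<and> compact_map D \<longrightarrow> D = (\<lambda>_. 0))))
     \<and>
     ((\<forall>D :: 'a \<Rightarrow> 'a cdual.
          derivation dual_lact dual_ract D \<and> weakly_compact_map D \<longrightarrow> D = (\<lambda>_. 0)) \<longrightarrow>
        (\<forall>(lact :: 'a \<Rightarrow> 'e \<Rightarrow> 'e) ract.
            symmetric_banach_bimodule lact ract \<longrightarrow>
            (\<forall>D. derivation lact ract D \<and> weakly_compact_map D \<longrightarrow> D = (\<lambda>_. 0))))"
proof (intro conjI allI impI; (elim conjE)?)
  fix n :: nat and lact :: "'a \<Rightarrow> 'e \<Rightarrow> 'e" and ract D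
  assume hyp: "\<forall>D :: 'a \<Rightarrow> 'a cdual. derivation dual_lact dual_ract D \<and> bounded_linear D \<and>
      complex_rank D < enat n \<longrightarrow> D = (\<lambda>_. 0)"
    and E: "symmetric_banach_bimodule lact ract"
    and D: "derivation lact ract D" "bounded_linear D" "complex_rank D < enat n"
  interpret symmetric_banach_bimodule lact ract by (rule E)
  show "D = (\<lambda>_. 0)"
    \<comment> \<open>The auxiliary derivations \<open>a \<mapsto> \<phi> a \<cdot> \<phi>\<close> have rank at most one, so the hypothesis covers them
      for \<open>n \<ge> 2\<close>; for \<open>n = 1\<close> the rank bound itself forces \<open>D = 0\<close>.\<close>
  proof (cases "n \<le> 1")
    case True
    with D(3) have "complex_rank D < enat 1" by (meson enat_ord_simps(1) order_less_le_trans)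
    then show ?thesis by (rule complex_rank_less_one)
  next
    case False
    show ?thesis
    proof (rule derivation_eq_zero[OF E D(1)])
      show "bounded_linear (\<lambda>a. cdual_apply \<psi> (D a))" for \<psi>
        by (rule bounded_linear_compose[OF bounded_linear_cdual_apply D(2)])
      show "(\<lambda>a. orbit_functional lact \<psi> (D a)) = (\<lambda>_. 0)" for \<psi>
        by (intro hyp[rule_format] conjI derivation_orbit_functional[OF E D(1)]
            bounded_linear_compose[OF bounded_linear_orbit_functional D(2)]
            complex_rank_compose_less[OF linear_orbit_functional D(3)])
      show "(\<lambda>a. cdual_apply \<phi> a *\<^sub>C \<phi>) = (\<lambda>_. 0)"
        if "derivation dual_lact dual_ract (\<lambda>a. cdual_apply \<phi> a *\<^sub>C \<phi>)" for \<phi> :: "'a cdual"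
      proof -
        have "enat 1 < enat n" using False by simp
        with complex_rank_rank_one[of "cdual_apply \<phi>" \<phi>]
        have "complex_rank (\<lambda>a. cdual_apply \<phi> a *\<^sub>C \<phi>) < enat n"
          by (rule order_le_less_trans)
        with that show ?thesis
          by (intro hyp[rule_format] conjI
              bounded_linear_compose[OF bounded_linear_scaleC_left bounded_linear_cdual_apply])
      qed
    qed
  qed
next
  fix lact :: "'a \<Rightarrow> 'e \<Rightarrow> 'e" and ract D
  assume hyp: "\<forall>D :: 'a \<Rightarrow> 'a cdual. derivation dual_lact dual_ract D \<and> compact_map D \<longrightarrow> D = (\<lambda>_. 0)"
    and E: "symmetric_banach_bimodule lact ract"
    and D: "derivation lact ract D" "compact_map D"
  interpret symmetric_banach_bimodule lact ract by (rule E)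
  have lin: "linear D" using D(1) by (simp add: derivation_def complex_linear_imp_linear)
  show "D = (\<lambda>_. 0)"
  proof (rule derivation_eq_zero[OF E D(1)])
    show "bounded_linear (\<lambda>a. cdual_apply \<psi> (D a))" for \<psi>
      by (rule weakly_compact_map_bounded_linear_cdual
          [OF compact_map_imp_weakly_compact_map[OF D(2)] lin])
    show "(\<lambda>a. orbit_functional lact \<psi> (D a)) = (\<lambda>_. 0)" for \<psi>
      by (intro hyp[rule_format] conjI derivation_orbit_functional[OF E D(1)]
          compact_map_compose[OF bounded_linear_orbit_functional D(2)])
    show "(\<lambda>a. cdual_apply \<phi> a *\<^sub>C \<phi>) = (\<lambda>_. 0)"
      if "derivation dual_lact dual_ract (\<lambda>a. cdual_apply \<phi> a *\<^sub>C \<phi>)" for \<phi> :: "'a cdual"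
      by (intro hyp[rule_format] conjI that compact_map_rank_one)
  qed
next
  fix lact :: "'a \<Rightarrow> 'e \<Rightarrow> 'e" and ract D
  assume hyp: "\<forall>D :: 'a \<Rightarrow> 'a cdual. derivation dual_lact dual_ract D \<and> weakly_compact_map D \<longrightarrow>
      D = (\<lambda>_. 0)"
    and E: "symmetric_banach_bimodule lact ract"
    and D: "derivation lact ract D" "weakly_compact_map D"
  interpret symmetric_banach_bimodule lact ract by (rule E)
  have lin: "linear D" using D(1) by (simp add: derivation_def complex_linear_imp_linear)
  show "D = (\<lambda>_. 0)"
  proof (rule derivation_eq_zero[OF E D(1)])
    show "bounded_linear (\<lambda>a. cdual_apply \<psi> (D a))" for \<psi>
      by (rule weakly_compact_map_bounded_linear_cdual[OF D(2) lin])
    show "(\<lambda>a. orbit_functional lact \<psi> (D a)) = (\<lambda>_. 0)" for \<psi>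
      by (intro hyp[rule_format] conjI derivation_orbit_functional[OF E D(1)]
          weakly_compact_map_compose[OF bounded_linear_orbit_functional orbit_functional_scaleC D(2)])
    show "(\<lambda>a. cdual_apply \<phi> a *\<^sub>C \<phi>) = (\<lambda>_. 0)"
      if "derivation dual_lact dual_ract (\<lambda>a. cdual_apply \<phi> a *\<^sub>C \<phi>)" for \<phi> :: "'a cdual"
      by (intro hyp[rule_format] conjI that
          compact_map_imp_weakly_compact_map[OF compact_map_rank_one])
  qed
qed

end
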